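(* For $n\ge1$ let $Q_n(x,z)=\sum_{\sigma\in\mathcal{S}_n}x^{\overrightarrow{des}_O(\sigma)}z^{\chi(\sigma_1\text{ odd})}$. Then (1) $Q_1(x,z)=z$ and $Q_2(x,z)=z+x$; (2) for all $n\ge1$, $Q_{2n+1}(x,z)=\Phi_{2n}(Q_{2n}(x,z))$; (3) for all $n\ge1$, $Q_{2n+2}(x,z)=\Psi_{2n+1}(Q_{2n+1}(x,z))$, where $\Phi_{2n}$ is the linear operator (on polynomials of degree at most 1 in $z$) sending $z^0x^k\mapsto z^1x^k+(n+k)z^0x^k+(n-k)z^0x^{k+1}$ and $z^1x^k\mapsto (n+k+1)z^1x^k+(n-k)z^1x^{k+1}$, and $\Psi_{2n+1}$ is the linear operator sending $z^0x^k\mapsto (n+k+1)z^0x^k+(n-k+1)z^0x^{k+1}$ and $z^1x^k\mapsto (n+k+1)z^1x^k+z^0x^{k+1}+(n-k)z^1x^{k+1}$.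
   Context: $\mathcal{S}_n$ denotes the set of permutations $\sigma=\sigma_1\cdots\sigma_n$ of $\{1,\dots,n\}$. $\overrightarrow{des}_O(\sigma)$ is the number of indices $i\in\{1,\dots,n-1\}$ with $\sigma_i>\sigma_{i+1}$ and $\sigma_{i+1}$ odd. $\chi(\sigma_1\text{ odd})$ is $1$ if $\sigma_1$ is odd and $0$ otherwise. *)

theory Defs
  imports "HOL-Computational_Algebra.Polynomial" "HOL-Combinatorics.Permutations"
begin

definition des_O :: "nat \<Rightarrow> (nat \<Rightarrow> nat) \<Rightarrow> nat" where
  "des_O n \<sigma> = card {i \<in> {1..n - 1}. \<sigma> i > \<sigma> (i + 1) \<and> odd (\<sigma> (i + 1))}"

text \<open>Polynomials in \<open>x\<close> and \<open>z\<close> are represented in \<open>\<int>[x][z]\<close>: the outer variable is \<open>z\<close>,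
  the inner one is \<open>x\<close>. Thus \<open>zx i k\<close> is the monomial \<open>z^i x^k\<close>.\<close>

definition zx :: "nat \<Rightarrow> nat \<Rightarrow> int poly poly" where
  "zx i k = monom (monom 1 k) i"

definition Q :: "nat \<Rightarrow> int poly poly" where
  "Q n = (\<Sum>\<sigma> | \<sigma> permutes {1..n}. zx (if odd (\<sigma> 1) then 1 else 0) (des_O n \<sigma>))"

text \<open>The linear operator on polynomials of degree at most 1 in \<open>z\<close> with prescribed images
  \<open>z^0 x^k \<mapsto> f k\<close> and \<open>z^1 x^k \<mapsto> g k\<close>. Terms of higher degree in \<open>z\<close>, which are outside
  the intended domain, are sent to 0.\<close>

definition lin_ext ::
    "(nat \<Rightarrow> int poly poly) \<Rightarrow> (nat \<Rightarrow> int poly poly) \<Rightarrow> int poly poly \<Rightarrow> int poly poly" where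
  "lin_ext f g p =
     (\<Sum>k\<le>degree (coeff p 0). of_int (coeff (coeff p 0) k) * f k) +
     (\<Sum>k\<le>degree (coeff p 1). of_int (coeff (coeff p 1) k) * g k)"

text \<open>\<open>Phi n\<close> and \<open>Psi n\<close> are the operators with index \<open>2n\<close> and \<open>2n+1\<close>, respectively.\<close>

definition Phi :: "nat \<Rightarrow> int poly poly \<Rightarrow> int poly poly" where
  "Phi n = lin_ext
     (\<lambda>k. zx 1 k + of_int (int n + int k) * zx 0 k + of_int (int n - int k) * zx 0 (k + 1))
     (\<lambda>k. of_int (int n + int k + 1) * zx 1 k + of_int (int n - int k) * zx 1 (k + 1))"

definition Psi :: "nat \<Rightarrow> int poly poly \<Rightarrow> int poly poly" where
  "Psi n = lin_ext
     (\<lambda>k. of_int (int n + int k + 1) * zx 0 k + of_int (int n - int k + 1) * zx 0 (k + 1))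
     (\<lambda>k. of_int (int n + int k + 1) * zx 1 k + zx 0 (k + 1) + of_int (int n - int k) * zx 1 (k + 1))"

lemma lin_ext_bound:
  assumes "degree (coeff p 0) \<le> N" "degree (coeff p 1) \<le> N"
  shows "lin_ext f g p =
     (\<Sum>k\<le>N. of_int (coeff (coeff p 0) k) * f k) + (\<Sum>k\<le>N. of_int (coeff (coeff p 1) k) * g k)"
  unfolding lin_ext_def using assms
  by (intro arg_cong2[where f = "(+)"] sum.mono_neutral_left) (auto simp: coeff_eq_0)

lemma lin_ext_add: "lin_ext f g (p + q) = lin_ext f g p + lin_ext f g q"
proof -
  define N where "N = degree (coeff p 0) + degree (coeff p 1) + degree (coeff q 0) + degree (coeff q 1)"
  have "degree (coeff (p + q) 0) \<le> N" "degree (coeff (p + q) 1) \<le> N"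
    unfolding N_def coeff_add by (auto intro!: degree_add_le)
  moreover have "degree (coeff p 0) \<le> N" "degree (coeff p 1) \<le> N"
      "degree (coeff q 0) \<le> N" "degree (coeff q 1) \<le> N"
    by (simp_all add: N_def)
  ultimately show ?thesis
    by (simp add: lin_ext_bound[where N = N] sum.distrib algebra_simps)
qed

lemma lin_ext_scale: "lin_ext f g (of_int c * p) = of_int c * lin_ext f g p"
proof -
  define N where "N = degree (coeff p 0) + degree (coeff p 1)"
  have c: "coeff (coeff (of_int c * p) i) k = c * coeff (coeff p i) k" for i k
    by (simp add: of_int_poly)
  have "degree (coeff (of_int c * p) i) \<le> degree (coeff p i)" for i
    by (rule degree_le) (simp add: c coeff_eq_0)
  then have "degree (coeff (of_int c * p) 0) \<le> N" "degree (coeff (of_int c * p) 1) \<le> N"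
    unfolding N_def by (meson le_add1 le_add2 le_trans)+
  moreover have "degree (coeff p 0) \<le> N" "degree (coeff p 1) \<le> N"
    by (simp_all add: N_def)
  ultimately show ?thesis
    by (simp add: lin_ext_bound[where N = N] c sum_distrib_left distrib_left mult.assoc)
qed

lemma lin_ext_zx:
  "lin_ext f g (zx 0 k) = f k"
  "lin_ext f g (zx 1 k) = g k"
proof -
  have *: "(\<Sum>j\<le>k. of_int (if k = j then 1 else 0) * h j) = h k" for h :: "nat \<Rightarrow> int poly poly"
    by (subst sum.mono_neutral_right[where S = "{k}"]) auto
  show "lin_ext f g (zx 0 k) = f k" "lin_ext f g (zx 1 k) = g k"
    using * by (simp_all add: lin_ext_def zx_def degree_monom_eq)
qed

end

theory Submission
  imports Defs "HOL-Combinatorics.Multiset_Permutations"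
begin

text \<open>Every permutation of \<open>{1..m+1}\<close> arises from a unique permutation of \<open>{1..m}\<close> by inserting the
  letter \<open>m+1\<close>. Since this letter is larger than all others, an insertion never destroys a descent
  with odd bottom, and it creates one exactly if it takes place directly before an odd letter that is
  not yet the bottom of a descent. Insertion at the front is treated separately, as it alone changes
  the parity of the first letter; the remaining positions are counted by induction on the word.\<close>

section \<open>Permutations as words\<close>

text \<open>Permutations fix every point outside \<open>set xs\<close>, which gives injectivity;
  surjectivity then follows by comparing finite cardinalities.\<close>

lemma bij_betw_permutes_permutations_of_set:
  assumes "distinct xs"
  shows "bij_betw (\<lambda>\<sigma>. map \<sigma> xs) {\<sigma>. \<sigma> permutes set xs} (permutations_of_set (set xs))"
proof -
  have inj: "inj_on (\<lambda>\<sigma>. map \<sigma> xs) {\<sigma>. \<sigma> permutes set xs}"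
  proof (rule inj_onI, rule ext)
    fix \<sigma> \<tau> x
    assume "\<sigma> \<in> {\<sigma>. \<sigma> permutes set xs}" "\<tau> \<in> {\<sigma>. \<sigma> permutes set xs}" "map \<sigma> xs = map \<tau> xs"
    then show "\<sigma> x = \<tau> x"
      by (cases "x \<in> set xs") (auto simp: permutes_not_in)
  qed
  have "(\<lambda>\<sigma>. map \<sigma> xs) ` {\<sigma>. \<sigma> permutes set xs} \<subseteq> permutations_of_set (set xs)"
    using assms
    by (auto simp: permutations_of_set_def distinct_map permutes_image permutes_inj_on)
  moreover have "card ((\<lambda>\<sigma>. map \<sigma> xs) ` {\<sigma>. \<sigma> permutes set xs}) = card (permutations_of_set (set xs))"
    using inj by (simp add: card_image card_permutations)
  ultimately have "(\<lambda>\<sigma>. map \<sigma> xs) ` {\<sigma>. \<sigma> permutes set xs} = permutations_of_set (set xs)"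
    by (intro card_subset_eq) auto
  with inj show ?thesis
    by (simp add: bij_betw_def)
qed

fun insertions :: "'a \<Rightarrow> 'a list \<Rightarrow> 'a list list" where
  "insertions a [] = [[a]]"
| "insertions a (y # ys) = (a # y # ys) # map ((#) y) (insertions a ys)"

lemma distinct_insertions: "a \<notin> set xs \<Longrightarrow> distinct (insertions a xs)"
  by (induction xs) (auto simp: distinct_map)

lemma mem_insertions_iff:
  assumes "a \<notin> set xs"
  shows "zs \<in> set (insertions a xs) \<longleftrightarrow> a \<in> set zs \<and> remove1 a zs = xs"
  using assms
proof (induction xs arbitrary: zs)
  case Nil
  show ?case
    by (cases zs) auto
next
  case (Cons y ys)
  then show ?case
    by (cases zs) auto
qed

text \<open>Words are grouped by what remains after deleting \<open>a\<close>. The fibre over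
  \<open>xs\<close> consists of its insertions, which are pairwise distinct as \<open>a\<close> is
  fresh, so the list sum is a set sum.\<close>

lemma sum_permutations_of_set_insert:
  assumes "finite A" "a \<notin> A"
  shows "sum f (permutations_of_set (insert a A)) =
    (\<Sum>xs\<in>permutations_of_set A. \<Sum>zs\<leftarrow>insertions a xs. f zs)"
proof -
  let ?S = "permutations_of_set (insert a A)"
  have "remove1 a ` ?S \<subseteq> permutations_of_set A"
    using assms by (auto simp: permutations_of_set_def)
  then have "sum f ?S =
      (\<Sum>xs\<in>permutations_of_set A. sum f {zs. zs \<in> ?S \<and> remove1 a zs = xs})"
    by (simp add: sum.group)
  also have "\<dots> = (\<Sum>xs\<in>permutations_of_set A. \<Sum>zs\<leftarrow>insertions a xs. f zs)"
  proof (rule sum.cong)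
    fix xs assume "xs \<in> permutations_of_set A"
    then have xs: "set xs = A" "distinct xs"
      by (auto dest: permutations_of_setD)
    have *: "zs \<in> ?S" if zs: "a \<in> set zs" "remove1 a zs = xs" for zs
    proof -
      from zs have "mset zs = mset (a # xs)"
        by auto
      then have "set zs = set (a # xs)" "distinct zs = distinct (a # xs)"
        by (rule mset_eq_setD, rule mset_eq_imp_distinct_iff)
      with xs assms show ?thesis
        by (auto simp: permutations_of_set_def)
    qed
    have "a \<in> set zs" if "zs \<in> ?S" for zs
      using permutations_of_setD(1)[OF that] by simp
    then have "{zs. zs \<in> ?S \<and> remove1 a zs = xs} = {zs. a \<in> set zs \<and> remove1 a zs = xs}"
      using * by blast
    also have "\<dots> = set (insertions a xs)"
      using xs assms by (auto simp: mem_insertions_iff)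
    finally show "sum f {zs. zs \<in> ?S \<and> remove1 a zs = xs} = (\<Sum>zs\<leftarrow>insertions a xs. f zs)"
      using xs assms by (simp add: sum_list_distinct_conv_sum_set distinct_insertions)
  qed simp
  finally show ?thesis .
qed

section \<open>Descents with odd bottom\<close>

fun desO :: "nat list \<Rightarrow> nat" where
  "desO (x # y # ys) = of_bool (y < x \<and> odd y) + desO (y # ys)"
| "desO _ = 0"

text \<open>Lowering the left end \<open>a\<close> in the induction prepends one letter. Position
  \<open>b\<close> has no successor in the word, hence \<open>{a..<b}\<close>.\<close>

lemma desO_map_upt:
  assumes "a \<le> b"
  shows "desO (map f [a..<Suc b]) = card {i \<in> {a..<b}. f (i + 1) < f i \<and> odd (f (i + 1))}"
  using assms
proof (induction rule: inc_induct)
  case base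
  show ?case by simp
next
  case (step a)
  let ?P = "\<lambda>i. f (i + 1) < f i \<and> odd (f (i + 1))"
  have "{i \<in> {a..<b}. ?P i} =
      (if ?P a then insert a {i \<in> {Suc a..<b}. ?P i} else {i \<in> {Suc a..<b}. ?P i})"
    using step.hyps by (auto simp: Suc_le_eq le_less)
  moreover have "desO (map f [a..<Suc b]) = of_bool (?P a) + desO (map f [Suc a..<Suc b])"
    using step.hyps by (simp add: upt_conv_Cons del: upt_Suc)
  ultimately show ?case
    using step.IH by simp
qed

definition odds :: "nat list \<Rightarrow> nat" where
  "odds xs = length (filter odd xs)"

lemma odds_simps [simp]: "odds [] = 0" "odds (x # xs) = of_bool (odd x) + odds xs"
  by (simp_all add: odds_def)

text \<open>Makes the coefficients of the insertion formula depend on the word only through its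
  first letter and \<open>desO\<close>.\<close>

lemma odds_permutation:
  assumes "xs \<in> permutations_of_set {1..m}"
  shows "odds xs = (m + 1) div 2"
proof -
  have "odds xs = card {i \<in> {1..m}. odd i}"
    using assms distinct_card[of "filter odd xs"]
    by (auto simp: odds_def permutations_of_set_def)
  also have "\<dots> = (m + 1) div 2"
  proof (induction m)
    case (Suc m)
    have "{i \<in> {1..Suc m}. odd i} =
        (if odd (Suc m) then insert (Suc m) {i \<in> {1..m}. odd i} else {i \<in> {1..m}. odd i})"
      by (auto simp: le_Suc_eq)
    with Suc have "card {i \<in> {1..Suc m}. odd i} = of_bool (even m) + (m + 1) div 2"
      by simp
    also have "\<dots> = (Suc m + 1) div 2"
      by (cases "even m") (auto elim!: evenE oddE)
    finally show ?case .
  qed simp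
  finally show ?thesis .
qed

text \<open>The fixed first letter \<open>p\<close> rules out insertion at the front.\<close>

lemma sum_insertions_desO:
  fixes F :: "nat \<Rightarrow> 'a::comm_ring_1"
  assumes "\<forall>x\<in>set (p # xs). x < N"
  shows "(\<Sum>zs\<leftarrow>insertions N xs. F (desO (p # zs))) =
    of_int (int (length xs) + 1 + int (desO (p # xs)) - int (odds xs)) * F (desO (p # xs)) +
    of_int (int (odds xs) - int (desO (p # xs))) * F (desO (p # xs) + 1)"
  using assms
proof (induction xs arbitrary: p F)
  case (Cons y ys)
  \<comment> \<open>Insertions behind \<open>y\<close>: the induction hypothesis applies with
    \<open>y\<close> as fixed first letter and \<open>F\<close> shifted by the contribution of the
    pair \<open>p\<close>, \<open>y\<close>.\<close>
  have "(\<Sum>zs\<leftarrow>insertions N ys. F (of_bool (y < p \<and> odd y) + desO (y # zs))) =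
    of_int (int (length ys) + 1 + int (desO (y # ys)) - int (odds ys)) *
      F (of_bool (y < p \<and> odd y) + desO (y # ys)) +
    of_int (int (odds ys) - int (desO (y # ys))) *
      F (of_bool (y < p \<and> odd y) + (desO (y # ys) + 1))"
    using Cons.prems by (intro Cons.IH) auto
  \<comment> \<open>The remaining insertion, between \<open>p\<close> and \<open>y\<close>, replaces
    that pair by an ascent to \<open>N\<close> and a descent to \<open>y\<close>; the count rises by
    one exactly if \<open>y\<close> is odd and not below \<open>p\<close>.\<close>
  with Cons.prems show ?case
    by (cases "y < p"; cases "odd y") (auto simp: o_def algebra_simps)
qed auto

definition wt :: "nat list \<Rightarrow> int poly poly" where
  "wt xs = zx (of_bool (odd (hd xs))) (desO xs)"

lemma Q_eq_sum_words:
  assumes "m \<ge> 1"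
  shows "Q m = (\<Sum>xs\<in>permutations_of_set {1..m}. wt xs)"
proof -
  have set_eq: "set [1..<Suc m] = {1..m}"
    by auto
  have "Q m = (\<Sum>\<sigma> | \<sigma> permutes {1..m}. wt (map \<sigma> [1..<Suc m]))"
    unfolding Q_def
  proof (rule sum.cong)
    fix \<sigma> :: "nat \<Rightarrow> nat"
    have "{1..m - 1} = {1..<m}"
      using assms by auto
    then have "des_O m \<sigma> = desO (map \<sigma> [1..<Suc m])"
      using desO_map_upt[of 1 m \<sigma>] assms by (simp add: des_O_def del: upt_Suc)
    moreover have "hd (map \<sigma> [1..<Suc m]) = \<sigma> 1"
      using assms by (simp add: hd_map del: upt_Suc)
    ultimately show "zx (if odd (\<sigma> 1) then 1 else 0) (des_O m \<sigma>) = wt (map \<sigma> [1..<Suc m])"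
      by (simp add: wt_def)
  qed simp
  also have "\<dots> = (\<Sum>xs\<in>permutations_of_set {1..m}. wt xs)"
    using sum.reindex_bij_betw[OF bij_betw_permutes_permutations_of_set[of "[1..<Suc m]"], of wt]
    unfolding set_eq by simp
  finally show ?thesis .
qed

text \<open>The first summand is insertion at the front, where the old first letter becomes a
  descent bottom. All other insertions keep the first letter, so only odd letters of the tail count
  for them.\<close>

lemma sum_insertions_wt:
  assumes "xs \<noteq> []" "\<forall>x\<in>set xs. x < N"
  shows "(\<Sum>zs\<leftarrow>insertions N xs. wt zs) =
    zx (of_bool (odd N)) (of_bool (odd (hd xs)) + desO xs) +
    of_int (int (length xs) + int (desO xs) + of_bool (odd (hd xs)) - int (odds xs)) * wt xs +
    of_int (int (odds xs) - of_bool (odd (hd xs)) - int (desO xs)) *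
      zx (of_bool (odd (hd xs))) (desO xs + 1)"
proof -
  obtain y ys where xs: "xs = y # ys"
    using assms(1) by (cases xs) auto
  have "(\<Sum>zs\<leftarrow>insertions N ys. zx (of_bool (odd y)) (desO (y # zs))) =
    of_int (int (length ys) + 1 + int (desO (y # ys)) - int (odds ys)) *
      zx (of_bool (odd y)) (desO (y # ys)) +
    of_int (int (odds ys) - int (desO (y # ys))) * zx (of_bool (odd y)) (desO (y # ys) + 1)"
    using assms(2) by (intro sum_insertions_desO) (simp add: xs)
  then show ?thesis
    using assms(2) by (auto simp: xs wt_def o_def algebra_simps)
qed

section \<open>The recursion\<close>

lemma lin_ext_sum: "lin_ext f g (sum h A) = (\<Sum>a\<in>A. lin_ext f g (h a))"
proof (induction A rule: infinite_finite_induct)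
  case (insert a A)
  then show ?case
    by (simp add: lin_ext_add)
qed (simp_all add: lin_ext_def)

lemma lin_ext_wt:
  "lin_ext f g (wt xs) = (if odd (hd xs) then g (desO xs) else f (desO xs))"
  using lin_ext_zx by (auto simp: wt_def)

text \<open>By linearity, the recursion reduces to an identity for the insertions into a single
  word.\<close>

lemma Q_Suc_eq_lin_ext:
  assumes "m \<ge> 1"
    and "\<And>xs. xs \<in> permutations_of_set {1..m} \<Longrightarrow>
      (\<Sum>zs\<leftarrow>insertions (Suc m) xs. wt zs) = lin_ext f g (wt xs)"
  shows "Q (Suc m) = lin_ext f g (Q m)"
proof -
  have "{1..Suc m} = insert (Suc m) {1..m}"
    by auto
  then have "Q (Suc m) =
      (\<Sum>xs\<in>permutations_of_set {1..m}. \<Sum>zs\<leftarrow>insertions (Suc m) xs. wt zs)"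
    by (simp add: Q_eq_sum_words sum_permutations_of_set_insert)
  with assms show ?thesis
    by (simp add: Q_eq_sum_words lin_ext_sum)
qed

lemma sum_insertions_wt_permutation:
  assumes "xs \<in> permutations_of_set {1..m}" "m \<ge> 1"
  shows "(\<Sum>zs\<leftarrow>insertions (Suc m) xs. wt zs) =
    zx (of_bool (even m)) (of_bool (odd (hd xs)) + desO xs) +
    of_int (int m + int (desO xs) + of_bool (odd (hd xs)) - int ((m + 1) div 2)) * wt xs +
    of_int (int ((m + 1) div 2) - of_bool (odd (hd xs)) - int (desO xs)) *
      zx (of_bool (odd (hd xs))) (desO xs + 1)"
proof -
  have "set xs = {1..m}" "length xs = m"
    using assms(1) by (auto dest: permutations_of_setD length_finite_permutations_of_set)
  moreover from this assms(2) have "xs \<noteq> []" "\<forall>x\<in>set xs. x < Suc m"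
    by auto
  ultimately show ?thesis
    using odds_permutation[OF assms(1)] by (simp add: sum_insertions_wt)
qed

text \<open>There are \<open>n\<close> odd letters and the new letter is odd. If the first letter is
  odd too, front insertion yields \<open>zx 1 (k + 1)\<close>, raising the coefficient
  \<open>n - k - 1\<close> to \<open>n - k\<close>.\<close>

lemma Q_odd:
  assumes "n \<ge> 1"
  shows "Q (2 * n + 1) = Phi n (Q (2 * n))"
proof -
  have "Q (Suc (2 * n)) = Phi n (Q (2 * n))"
    unfolding Phi_def
  proof (rule Q_Suc_eq_lin_ext, goal_cases)
    case (2 xs)
    show ?case
      unfolding lin_ext_wt using sum_insertions_wt_permutation[OF 2] assms
      by (cases "odd (hd xs)") (simp_all add: wt_def algebra_simps)
  qed (use assms in simp)
  then show ?thesis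
    by simp
qed

text \<open>There are \<open>n + 1\<close> odd letters and the new letter is even. If the first
  letter is even too, front insertion yields \<open>zx 0 k\<close>, raising \<open>n + k\<close> to
  \<open>n + k + 1\<close>.\<close>

lemma Q_even: "Q (2 * n + 2) = Psi n (Q (2 * n + 1))"
proof -
  have "Q (Suc (2 * n + 1)) = Psi n (Q (2 * n + 1))"
    unfolding Psi_def
  proof (rule Q_Suc_eq_lin_ext, goal_cases)
    case (2 xs)
    show ?case
      unfolding lin_ext_wt using sum_insertions_wt_permutation[OF 2]
      by (cases "odd (hd xs)") (simp_all add: wt_def algebra_simps)
  qed simp
  then show ?thesis
    by simp
qed

lemma Q_1: "Q 1 = zx 1 0"
  using Q_eq_sum_words[of 1] by (simp add: wt_def)

theorem theorem5p1:
  shows "(Q 1 = zx 1 0 \<and> Q 2 = zx 1 0 + zx 0 1) \<and>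
    (\<forall>n\<ge>1. Q (2 * n + 1) = Phi n (Q (2 * n))) \<and>
    (\<forall>n\<ge>1. Q (2 * n + 2) = Psi n (Q (2 * n + 1)))"
proof -
  \<comment> \<open>The even recursion also holds at \<open>n = 0\<close>, so \<open>Q 2\<close>
    needs no enumeration of permutations.\<close>
  have "Q 2 = Psi 0 (Q 1)"
    using Q_even[of 0] by (simp add: numeral_2_eq_2)
  also have "\<dots> = zx 1 0 + zx 0 1"
    unfolding Q_1 Psi_def lin_ext_zx by simp
  finally show ?thesis
    using Q_1 Q_odd Q_even by blast
qed

end
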